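(* Let $n$ be a positive integer. For every $g \in D_n$ and all $p, q \in \mathbb{Z}_n$, one has $\mathrm{ic}(g(p), g(q)) = \mathrm{ic}(p, q)$.
   Context: Elements of $\mathbb{Z}_n = \mathbb{Z}/n\mathbb{Z}$ are represented by integers in $\{0, 1, \ldots, n-1\}$. The interval class of $p, q \in \mathbb{Z}_n$ is $\mathrm{ic}(p,q) = \min(|p-q|,\ n-|p-q|)$, computed with these representatives; for distinct $p,q$ it lies in $\{1,\ldots,\lfloor n/2\rfloor\}$. The dihedral group $D_n$ acts on $\mathbb{Z}_n$ by the transpositions $T_s(p) = p+s$ and the inversions $I_s(p) = s-p$ (mod $n$), $s \in \mathbb{Z}_n$. *)

theory Defs
  imports "HOL-Algebra.Algebra"
begin

definition Z_mod :: "int \<Rightarrow> int set" where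
  "Z_mod n = {0..n - 1}"

definition ic :: "int \<Rightarrow> int \<Rightarrow> int \<Rightarrow> int" where
  "ic n p q = min \<bar>p - q\<bar> (n - \<bar>p - q\<bar>)"

text \<open>
  The elements of the dihedral group are kept as formal symbols rather than as maps on the
  residues: for \<open>n \<le> 2\<close> the action is not faithful, and the maps alone would form a proper
  quotient of the group of order \<open>2n\<close>.
\<close>

datatype dihedral_elt = Transposition int | Inversion int

fun dihedral_mult :: "int \<Rightarrow> dihedral_elt \<Rightarrow> dihedral_elt \<Rightarrow> dihedral_elt" where
  "dihedral_mult n (Transposition s) (Transposition t) = Transposition ((s + t) mod n)"
| "dihedral_mult n (Transposition s) (Inversion t) = Inversion ((s + t) mod n)"
| "dihedral_mult n (Inversion s) (Transposition t) = Inversion ((s - t) mod n)"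
| "dihedral_mult n (Inversion s) (Inversion t) = Transposition ((s - t) mod n)"

definition dihedral_group :: "int \<Rightarrow> dihedral_elt monoid" where
  "dihedral_group n =
     \<lparr>carrier = Transposition ` Z_mod n \<union> Inversion ` Z_mod n,
      monoid.mult = dihedral_mult n,
      one = Transposition 0\<rparr>"

text \<open>The restriction to the residues makes the maps elements of \<open>BijGroup (Z_mod n)\<close>.\<close>

fun dihedral_action :: "int \<Rightarrow> dihedral_elt \<Rightarrow> int \<Rightarrow> int" where
  "dihedral_action n (Transposition s) = (\<lambda>p\<in>Z_mod n. (p + s) mod n)"
| "dihedral_action n (Inversion s) = (\<lambda>p\<in>Z_mod n. (s - p) mod n)"

lemma group_dihedral_group:
  assumes "n > 0"
  shows "group (dihedral_group n)"
proof (rule groupI)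
  fix x y assume "x \<in> carrier (dihedral_group n)" "y \<in> carrier (dihedral_group n)"
  then show "x \<otimes>\<^bsub>dihedral_group n\<^esub> y \<in> carrier (dihedral_group n)"
    using assms by (auto simp: dihedral_group_def Z_mod_def)
next
  show "\<one>\<^bsub>dihedral_group n\<^esub> \<in> carrier (dihedral_group n)"
    using assms by (auto simp: dihedral_group_def Z_mod_def)
next
  fix x y z
  assume "x \<in> carrier (dihedral_group n)" "y \<in> carrier (dihedral_group n)"
    "z \<in> carrier (dihedral_group n)"
  then show "x \<otimes>\<^bsub>dihedral_group n\<^esub> y \<otimes>\<^bsub>dihedral_group n\<^esub> z =
    x \<otimes>\<^bsub>dihedral_group n\<^esub> (y \<otimes>\<^bsub>dihedral_group n\<^esub> z)"
    by (cases x; cases y; cases z) (simp_all add: dihedral_group_def mod_simps algebra_simps)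
next
  fix x assume "x \<in> carrier (dihedral_group n)"
  then show "\<one>\<^bsub>dihedral_group n\<^esub> \<otimes>\<^bsub>dihedral_group n\<^esub> x = x"
    by (auto simp: dihedral_group_def Z_mod_def)
next
  fix x assume x: "x \<in> carrier (dihedral_group n)"
  show "\<exists>y\<in>carrier (dihedral_group n). y \<otimes>\<^bsub>dihedral_group n\<^esub> x = \<one>\<^bsub>dihedral_group n\<^esub>"
  proof (cases x)
    case (Transposition s)
    with x assms show ?thesis
      by (intro bexI[of _ "Transposition ((- s) mod n)"])
         (auto simp: dihedral_group_def Z_mod_def mod_simps)
  next
    case (Inversion s)
    with x assms show ?thesis
      by (intro bexI[of _ "Inversion s"]) (auto simp: dihedral_group_def Z_mod_def)
  qed
qed

lemma order_dihedral_group: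
  assumes "n > 0"
  shows "order (dihedral_group n) = 2 * nat n"
proof -
  have "card (Transposition ` Z_mod n \<union> Inversion ` Z_mod n) =
      card (Transposition ` Z_mod n) + card (Inversion ` Z_mod n)"
    by (rule card_Un_disjoint) (auto simp: Z_mod_def)
  then show ?thesis
    by (simp add: order_def dihedral_group_def card_image inj_on_def Z_mod_def)
qed

lemma dihedral_action_comp:
  assumes "n > 0" "p \<in> Z_mod n"
  shows "dihedral_action n (dihedral_mult n x y) p =
    dihedral_action n x (dihedral_action n y p)"
proof -
  have "k mod n \<in> Z_mod n" for k
    using assms(1) by (auto simp: Z_mod_def)
  then show ?thesis
    using assms by (cases x; cases y) (simp_all add: mod_simps algebra_simps)
qed

lemma dihedral_action_Bij:
  assumes "n > 0"
  shows "dihedral_action n x \<in> Bij (Z_mod n)"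
proof -
  have mem: "dihedral_action n y p \<in> Z_mod n" if "p \<in> Z_mod n" for y p
    using assms that by (cases y) (auto simp: Z_mod_def)
  obtain y where y: "dihedral_mult n y x = Transposition 0" "dihedral_mult n x y = Transposition 0"
  proof (cases x)
    case (Transposition s)
    then show thesis by (intro that[of "Transposition (- s)"]) simp_all
  next
    case (Inversion s)
    then show thesis by (intro that[of "Inversion s"]) simp_all
  qed
  have id: "dihedral_action n (Transposition 0) p = p" if "p \<in> Z_mod n" for p
    using that by (auto simp: Z_mod_def)
  have "bij_betw (dihedral_action n x) (Z_mod n) (Z_mod n)"
    by (rule bij_betw_byWitness[where f' = "dihedral_action n y"])
       (use mem id y dihedral_action_comp[OF assms] in \<open>metis image_subsetI\<close>)+
  moreover have "dihedral_action n x \<in> extensional (Z_mod n)"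
    by (cases x) auto
  ultimately show ?thesis by (simp add: Bij_def)
qed

lemma group_action_dihedral:
  assumes "n > 0"
  shows "group_action (dihedral_group n) (Z_mod n) (dihedral_action n)"
proof -
  have "dihedral_action n (dihedral_mult n x y) =
      compose (Z_mod n) (dihedral_action n x) (dihedral_action n y)" for x y
  proof (rule extensionalityI[of _ "Z_mod n"])
    show "dihedral_action n (dihedral_mult n x y) \<in> extensional (Z_mod n)"
      using dihedral_action_Bij[OF assms] Bij_imp_extensional by blast
  qed (simp_all add: compose_eq dihedral_action_comp[OF assms])
  then have "dihedral_action n \<in> hom (dihedral_group n) (BijGroup (Z_mod n))"
    using dihedral_action_Bij[OF assms]
    by (auto simp: hom_def BijGroup_def dihedral_group_def)
  then show ?thesis
    by (simp add: group_action_def group_hom_def group_hom_axioms_def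
        group_dihedral_group[OF assms] group_BijGroup)
qed

end

theory Submission
  imports Defs
begin

text \<open>
  The interval class is defined through integer representatives, but by
  \<open>ic_eq_min_residues\<close> it depends only on the unordered pair of residue classes
  of \<open>p - q\<close> and \<open>q - p\<close>. A transposition fixes both classes, since the
  shift cancels in the difference, and an inversion interchanges them.
\<close>

text \<open>
  For \<open>p > q\<close> the two residues are \<open>p - q\<close> and \<open>n - (p - q)\<close>, and the
  case \<open>p < q\<close> is symmetric. On the diagonal both residues are \<open>0\<close>, whereas the two
  terms in the definition are \<open>0\<close> and \<open>n\<close>; the minima still agree.
\<close>

lemma ic_eq_min_residues:
  assumes "p \<in> Z_mod n" and "q \<in> Z_mod n"
  shows "ic n p q = min ((p - q) mod n) ((q - p) mod n)"
proof -
  have residues: "(a - b) mod n = a - b" "(b - a) mod n = n - (a - b)"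
    if "a \<in> Z_mod n" "b \<in> Z_mod n" "b < a" for a b
  proof -
    show "(a - b) mod n = a - b"
      using that by (simp add: Z_mod_def)
    have "(b - a) mod n = (n - (a - b)) mod n"
      using mod_add_self1[of n "b - a"] by (simp add: algebra_simps)
    also have "\<dots> = n - (a - b)"
      using that by (intro mod_pos_pos_trivial) (auto simp: Z_mod_def)
    finally show "(b - a) mod n = n - (a - b)" .
  qed
  consider "p = q" | "q < p" | "p < q"
    by linarith
  then show ?thesis
  proof cases
    case 1
    then show ?thesis
      using assms by (simp add: ic_def Z_mod_def)
  next
    case 2
    then show ?thesis
      using residues[of p q] assms by (simp add: ic_def)
  next
    case 3
    then show ?thesis
      using residues[of q p] assms by (simp add: ic_def min.commute)
  qed
qed

theorem lemma1p2:
  fixes n :: int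
  assumes "n > 0"
    and "g \<in> carrier (dihedral_group n)"
    and "p \<in> Z_mod n" and "q \<in> Z_mod n"
  shows "ic n (dihedral_action n g p) (dihedral_action n g q) = ic n p q"
proof -
  have mem: "k mod n \<in> Z_mod n" for k
    using \<open>n > 0\<close> by (simp add: Z_mod_def)
  show ?thesis
  proof (cases g)
    case (Transposition s)
    then show ?thesis
      using assms(3,4) by (simp add: ic_eq_min_residues mem mod_simps)
  next
    case (Inversion s)
    then show ?thesis
      using assms(3,4) by (simp add: ic_eq_min_residues mem mod_simps min.commute)
  qed
qed

end
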